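(* All the eigenvalues of $A$ have non-positive real parts if and only if $$0\le \sigma_2,\qquad 0\le \phi_1,\qquad 0\le \phi_2,\qquad 0\le \phi_2^2-16\phi_1,$$ where $\phi_1=\sigma_1\sigma_3$ and $\phi_2=3\sigma_1+\sigma_3\sigma_1+1$. Moreover, if all these conditions are satisfied, the eigenvalues $s_1,\dots,s_6$ of $A$ (counted with algebraic multiplicity) are $$s_{1,2}=\pm\sqrt{3\sigma_2}\,\omega_0\mathrm{i},\qquad s_{3,4}=\pm\sqrt{\frac{\phi_2+\sqrt{\phi_2^2-16\phi_1}}{2}}\,\omega_0\mathrm{i},\qquad s_{5,6}=\pm\sqrt{\frac{\phi_2-\sqrt{\phi_2^2-16\phi_1}}{2}}\,\omega_0\mathrm{i}.$$
   Context: Let $J_x,J_y,J_z>0$ (inertias of the spacecraft) and $\omega_0>0$ (orbital rate) be real numbers, and set $$\sigma_1=\frac{J_y-J_z}{J_x},\qquad \sigma_2=\frac{J_x-J_z}{J_y},\qquad \sigma_3=\frac{J_y-J_x}{J_z}.$$ The matrix $A$ (state matrix of the linearized spacecraft attitude control system) is $$A=\begin{bmatrix}0&0&0&1&0&0\\0&0&0&0&1&0\\0&0&0&0&0&1\\-4\omega_0^2\sigma_1&0&0&0&0&\omega_0(1-\sigma_1)\\0&-3\omega_0^2\sigma_2&0&0&0&0\\0&0&-\omega_0^2\sigma_3&\omega_0(\sigma_3-1)&0&0\end{bmatrix}\in\mathbb{R}^{6\times 6}.$$ Here $\mathrm{i}$ is the imaginary unit. *)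

theory Defs
  imports "HOL-Computational_Algebra.Computational_Algebra" "Jordan_Normal_Form.Char_Poly"
begin

definition attitude_matrix :: "real \<Rightarrow> real \<Rightarrow> real \<Rightarrow> real \<Rightarrow> real mat" where
  "attitude_matrix \<omega>0 \<sigma>1 \<sigma>2 \<sigma>3 = mat_of_rows_list 6
    [[0, 0, 0, 1, 0, 0],
     [0, 0, 0, 0, 1, 0],
     [0, 0, 0, 0, 0, 1],
     [- 4 * \<omega>0\<^sup>2 * \<sigma>1, 0, 0, 0, 0, \<omega>0 * (1 - \<sigma>1)],
     [0, - 3 * \<omega>0\<^sup>2 * \<sigma>2, 0, 0, 0, 0],
     [0, 0, - \<omega>0\<^sup>2 * \<sigma>3, \<omega>0 * (\<sigma>3 - 1), 0, 0]]"

(* Eigenvalues are taken over the complex numbers; the roots of the characteristic polynomial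
   with multiplicity are the eigenvalues with algebraic multiplicity. *)
definition eigenvalue_mset :: "real mat \<Rightarrow> complex multiset" where
  "eigenvalue_mset A = proots (char_poly (map_mat complex_of_real A))"

end

theory Submission
  imports Defs
begin

text \<open>
  The system is of second order: with the position block \<open>q\<close> and the velocity block \<open>q'\<close> of
  the state, \<open>A\<close> encodes \<open>q'' = G q' + K q\<close>. Hence its characteristic polynomial is the
  determinant of the \<open>3 \<times> 3\<close> matrix \<open>X\<^sup>2 I - X G - K\<close> (\<open>det_companion_linearization\<close>). The
  middle (pitch) coordinate decouples from the other two (roll and yaw), so this determinant
  factors as
  \<open>(X\<^sup>2 + 3 \<sigma>\<^sub>2 \<omega>\<^sup>2) (X\<^sup>4 + \<phi>\<^sub>2 \<omega>\<^sup>2 X\<^sup>2 + 4 \<phi>\<^sub>1 \<omega>\<^sup>4)\<close>, a polynomial in \<open>X\<^sup>2\<close>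
  (\<open>char_poly_attitude_matrix\<close>).

  Consequently, if complex numbers \<open>a\<close>, \<open>b\<close>, \<open>c\<close> satisfy \<open>a\<^sup>2 = 3 \<sigma>\<^sub>2\<close>,
  \<open>b\<^sup>2 + c\<^sup>2 = \<phi>\<^sub>2\<close> and \<open>b\<^sup>2 c\<^sup>2 = 4 \<phi>\<^sub>1\<close>, then the eigenvalues are \<open>\<plusminus> a \<omega> \<i>\<close>,
  \<open>\<plusminus> b \<omega> \<i>\<close>, \<open>\<plusminus> c \<omega> \<i>\<close> (\<open>eigenvalue_mset_attitude_matrix\<close>). Such numbers
  always exist over the complex field. As the eigenvalues come in opposite pairs, none has positive
  real part exactly when all are purely imaginary, that is, when \<open>a\<close>, \<open>b\<close>, \<open>c\<close> are real.
  Real \<open>a\<close>, \<open>b\<close>, \<open>c\<close> force the four inequalities, the last one because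
  \<open>\<phi>\<^sub>2\<^sup>2 - 16 \<phi>\<^sub>1 = (b\<^sup>2 - c\<^sup>2)\<^sup>2\<close>. Conversely, under the inequalities the real square roots in
  the asserted list of eigenvalues are an admissible choice of \<open>a\<close>, \<open>b\<close>, \<open>c\<close>.
\<close>

text \<open>
  The determinant of the block matrix reduces to that of \<open>A D - B C\<close> when the two lower blocks
  commute. Here \<open>K\<close> and \<open>G\<close> need not commute, but after transposition the lower left block is \<open>- I\<close>,
  which commutes with everything.
\<close>
lemma det_companion_linearization:
  fixes K G :: "'a :: idom mat"
  assumes K: "K \<in> carrier_mat n n" and G: "G \<in> carrier_mat n n"
  shows "det (four_block_mat (x \<cdot>\<^sub>m 1\<^sub>m n) (- 1\<^sub>m n) (- K) (x \<cdot>\<^sub>m 1\<^sub>m n - G)) =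
         det (x\<^sup>2 \<cdot>\<^sub>m 1\<^sub>m n - x \<cdot>\<^sub>m G - K)" (is "det ?M = det ?Q")
proof -
  let ?I = "1\<^sub>m n :: 'a mat"
  have M: "?M \<in> carrier_mat (n + n) (n + n)" and Q: "?Q \<in> carrier_mat n n"
    using K G by auto
  have T: "transpose_mat ?M =
      four_block_mat (x \<cdot>\<^sub>m ?I) (- transpose_mat K) (- ?I) (x \<cdot>\<^sub>m ?I - transpose_mat G)"
    using K G by (intro eq_matI) auto
  have "det ?M = det (transpose_mat ?M)"
    using det_transpose[OF M] by simp
  also have "\<dots> = det (x \<cdot>\<^sub>m ?I * (x \<cdot>\<^sub>m ?I - transpose_mat G) - (- transpose_mat K) * (- ?I))"
    unfolding T using K G
    by (intro det_four_block_mat[where n = n]) auto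
  also have "x \<cdot>\<^sub>m ?I * (x \<cdot>\<^sub>m ?I - transpose_mat G) = x \<cdot>\<^sub>m (x \<cdot>\<^sub>m ?I - transpose_mat G)"
    using G by (subst mult_smult_assoc_mat[of _ n n]) auto
  also have "\<dots> - (- transpose_mat K) * (- ?I) = transpose_mat ?Q"
    using K G by (intro eq_matI) (auto simp: power2_eq_square algebra_simps)
  also have "det (transpose_mat ?Q) = det ?Q"
    by (rule det_transpose[OF Q])
  finally show ?thesis .
qed

lemma det_2x2:
  fixes B :: "'a :: comm_ring_1 mat"
  assumes "B \<in> carrier_mat 2 2"
  shows "det B = B $$ (0,0) * B $$ (1,1) - B $$ (0,1) * B $$ (1,0)"
proof -
  have "det B = (\<Sum>j<2. B $$ (0,j) * cofactor B 0 j)"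
    using assms by (intro laplace_expansion_row) auto
  moreover have "cofactor B 0 j = (-1) ^ j * B $$ (1, 1 - j)" if "j < 2" for j
    using that assms less_2_cases[OF that]
    by (auto simp: cofactor_def mat_delete_def det_single)
  ultimately show ?thesis by (simp add: numeral_2_eq_2)
qed

lemma det_cross:
  fixes a b c d e :: "'a :: comm_ring_1"
  shows "det (mat_of_rows_list 3 [[a, 0, b], [0, e, 0], [c, 0, d]]) = e * (a * d - b * c)"
    (is "det ?B = _")
proof -
  have "det ?B = (\<Sum>j<3. ?B $$ (1,j) * cofactor ?B 1 j)"
    by (intro laplace_expansion_row) (auto simp: mat_of_rows_list_def)
  also have "\<dots> = e * det (mat_delete ?B 1 1)"
    by (simp add: mat_of_rows_list_def numeral_eq_Suc cofactor_def)
  also have "det (mat_delete ?B 1 1) = a * d - b * c"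
    by (subst det_2x2) (auto simp: mat_delete_def mat_of_rows_list_def)
  finally show ?thesis .
qed

text \<open>
  The factor \<open>X\<^sup>2 + 3 \<sigma>\<^sub>2 w\<^sup>2\<close> is the pitch motion, the quartic is the roll-yaw motion; only the
  latter sees the gyroscopic block \<open>G\<close>, which contributes minus the product of its two entries to the
  coefficient of \<open>X\<^sup>2\<close>.
\<close>
lemma char_poly_attitude_matrix:
  fixes w \<sigma>1 \<sigma>2 \<sigma>3 :: real
  shows "char_poly (map_mat complex_of_real (attitude_matrix w \<sigma>1 \<sigma>2 \<sigma>3)) =
    [:complex_of_real (3 * w\<^sup>2 * \<sigma>2), 0, 1:] *
    [:complex_of_real (4 * w ^ 4 * (\<sigma>1 * \<sigma>3)), 0,
      complex_of_real (w\<^sup>2 * (3 * \<sigma>1 + \<sigma>3 * \<sigma>1 + 1)), 0, 1:]"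
proof -
  let ?c = "\<lambda>r. [:complex_of_real r:]"
  define K where "K = mat_of_rows_list 3
    [[?c (- 4 * w\<^sup>2 * \<sigma>1), 0, 0], [0, ?c (- 3 * w\<^sup>2 * \<sigma>2), 0], [0, 0, ?c (- w\<^sup>2 * \<sigma>3)]]"
  define G where "G = mat_of_rows_list 3
    [[0, 0, ?c (w * (1 - \<sigma>1))], [0, 0, 0], [?c (w * (\<sigma>3 - 1)), 0, 0]]"
  let ?X = "[:0, 1:] :: complex poly"
  have KG: "K \<in> carrier_mat 3 3" "G \<in> carrier_mat 3 3"
    by (auto simp: K_def G_def mat_of_rows_list_def)
  have "char_poly_matrix (map_mat complex_of_real (attitude_matrix w \<sigma>1 \<sigma>2 \<sigma>3)) =
      four_block_mat (?X \<cdot>\<^sub>m 1\<^sub>m 3) (- 1\<^sub>m 3) (- K) (?X \<cdot>\<^sub>m 1\<^sub>m 3 - G)"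
    by (rule eq_matI)
       (auto simp: char_poly_matrix_def attitude_matrix_def K_def G_def mat_of_rows_list_def
          less_Suc_eq numeral_eq_Suc)
  then have "char_poly (map_mat complex_of_real (attitude_matrix w \<sigma>1 \<sigma>2 \<sigma>3)) =
      det (?X\<^sup>2 \<cdot>\<^sub>m 1\<^sub>m 3 - ?X \<cdot>\<^sub>m G - K)"
    unfolding char_poly_def using det_companion_linearization[OF KG] by simp
  also have "?X\<^sup>2 \<cdot>\<^sub>m 1\<^sub>m 3 - ?X \<cdot>\<^sub>m G - K = mat_of_rows_list 3
     [[?X\<^sup>2 + ?c (4 * w\<^sup>2 * \<sigma>1), 0, - ?X * ?c (w * (1 - \<sigma>1))],
      [0, ?X\<^sup>2 + ?c (3 * w\<^sup>2 * \<sigma>2), 0],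
      [- ?X * ?c (w * (\<sigma>3 - 1)), 0, ?X\<^sup>2 + ?c (w\<^sup>2 * \<sigma>3)]]"
    by (rule eq_matI)
       (auto simp: K_def G_def mat_of_rows_list_def less_Suc_eq numeral_eq_Suc)
  also have "det \<dots> = [:complex_of_real (3 * w\<^sup>2 * \<sigma>2), 0, 1:] *
    [:complex_of_real (4 * w ^ 4 * (\<sigma>1 * \<sigma>3)), 0,
      complex_of_real (w\<^sup>2 * (3 * \<sigma>1 + \<sigma>3 * \<sigma>1 + 1)), 0, 1:]"
    unfolding det_cross
    by (rule arg_cong2[of _ _ _ _ "(*)"])
       (simp_all add: power2_eq_square power4_eq_xxxx algebra_simps)
  finally show ?thesis .
qed

text \<open>
  Leaving \<open>b\<^sup>2\<close> and \<open>c\<^sup>2\<close> as any complex pair with the sum and product prescribed by the quartic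
  lets the same spectrum serve both directions of the criterion: with complex square roots before
  any sign is known, and with real ones afterwards.
\<close>
lemma eigenvalue_mset_attitude_matrix:
  fixes w \<sigma>1 \<sigma>2 \<sigma>3 :: real and a b c :: complex
  assumes "a\<^sup>2 = 3 * \<sigma>2" and "b\<^sup>2 + c\<^sup>2 = 3 * \<sigma>1 + \<sigma>3 * \<sigma>1 + 1" and "b\<^sup>2 * c\<^sup>2 = 4 * (\<sigma>1 * \<sigma>3)"
  shows "eigenvalue_mset (attitude_matrix w \<sigma>1 \<sigma>2 \<sigma>3) =
    {# a * w * \<i>, - (a * w * \<i>), b * w * \<i>, - (b * w * \<i>), c * w * \<i>, - (c * w * \<i>) #}"
proof -
  have pair: "[:- (r * w * \<i>), 1:] * [:r * w * \<i>, 1:] = [:r\<^sup>2 * w\<^sup>2, 0, 1:]" for r :: complex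
    by (simp add: power2_eq_square mult_ac)
  have coeffs: "complex_of_real (w\<^sup>2 * (3 * \<sigma>1 + \<sigma>3 * \<sigma>1 + 1)) = w\<^sup>2 * (b\<^sup>2 + c\<^sup>2)"
    "complex_of_real (4 * w ^ 4 * (\<sigma>1 * \<sigma>3)) = w ^ 4 * (b\<^sup>2 * c\<^sup>2)"
    "complex_of_real (3 * w\<^sup>2 * \<sigma>2) = a\<^sup>2 * w\<^sup>2"
    unfolding assms by simp_all
  have "char_poly (map_mat complex_of_real (attitude_matrix w \<sigma>1 \<sigma>2 \<sigma>3)) =
    [:a\<^sup>2 * w\<^sup>2, 0, 1:] * ([:b\<^sup>2 * w\<^sup>2, 0, 1:] * [:c\<^sup>2 * w\<^sup>2, 0, 1:])"
    unfolding char_poly_attitude_matrix coeffs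
    by (simp add: power2_eq_square power4_eq_xxxx algebra_simps)
  then show ?thesis
    unfolding eigenvalue_mset_def pair[symmetric] 
    by (simp add: proots_mult del: mult_pCons_left mult_pCons_right)
qed

lemma eigenvalue_iff_mem_eigenvalue_mset:
  assumes "A \<in> carrier_mat n n"
  shows "eigenvalue (map_mat complex_of_real A) s \<longleftrightarrow> s \<in># eigenvalue_mset A"
proof -
  have M: "map_mat complex_of_real A \<in> carrier_mat n n"
    using assms by simp
  have "char_poly (map_mat complex_of_real A) \<noteq> 0"
    using degree_monic_char_poly[OF M] by auto
  then show ?thesis
    by (simp add: eigenvalue_root_char_poly[OF M] eigenvalue_mset_def)
qed

theorem proposition1:
  fixes Jx Jy Jz \<omega>0 \<sigma>1 \<sigma>2 \<sigma>3 \<phi>1 \<phi>2 :: real and A :: "real mat"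
  assumes "Jx > 0" and "Jy > 0" and "Jz > 0" and "\<omega>0 > 0"
    and "\<sigma>1 = (Jy - Jz) / Jx" and "\<sigma>2 = (Jx - Jz) / Jy" and "\<sigma>3 = (Jy - Jx) / Jz"
    and "A = attitude_matrix \<omega>0 \<sigma>1 \<sigma>2 \<sigma>3"
    and "\<phi>1 = \<sigma>1 * \<sigma>3" and "\<phi>2 = 3 * \<sigma>1 + \<sigma>3 * \<sigma>1 + 1"
  shows "((\<forall>s. eigenvalue (map_mat complex_of_real A) s \<longrightarrow> Re s \<le> 0) \<longleftrightarrow>
           0 \<le> \<sigma>2 \<and> 0 \<le> \<phi>1 \<and> 0 \<le> \<phi>2 \<and> 0 \<le> \<phi>2\<^sup>2 - 16 * \<phi>1) \<and>
         (0 \<le> \<sigma>2 \<and> 0 \<le> \<phi>1 \<and> 0 \<le> \<phi>2 \<and> 0 \<le> \<phi>2\<^sup>2 - 16 * \<phi>1 \<longrightarrow>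
           eigenvalue_mset A =
             {# complex_of_real (sqrt (3 * \<sigma>2)) * complex_of_real \<omega>0 * \<i>,
                - (complex_of_real (sqrt (3 * \<sigma>2)) * complex_of_real \<omega>0 * \<i>),
                complex_of_real (sqrt ((\<phi>2 + sqrt (\<phi>2\<^sup>2 - 16 * \<phi>1)) / 2)) * complex_of_real \<omega>0 * \<i>,
                - (complex_of_real (sqrt ((\<phi>2 + sqrt (\<phi>2\<^sup>2 - 16 * \<phi>1)) / 2)) * complex_of_real \<omega>0 * \<i>),
                complex_of_real (sqrt ((\<phi>2 - sqrt (\<phi>2\<^sup>2 - 16 * \<phi>1)) / 2)) * complex_of_real \<omega>0 * \<i>,
                - (complex_of_real (sqrt ((\<phi>2 - sqrt (\<phi>2\<^sup>2 - 16 * \<phi>1)) / 2)) * complex_of_real \<omega>0 * \<i>) #})"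
    (is "(?stable \<longleftrightarrow> ?cond) \<and> (?cond \<longrightarrow> eigenvalue_mset A = ?spec)")
proof -
  note \<phi> = \<open>\<phi>1 = \<sigma>1 * \<sigma>3\<close> \<open>\<phi>2 = 3 * \<sigma>1 + \<sigma>3 * \<sigma>1 + 1\<close>
  have "A \<in> carrier_mat 6 6"
    unfolding \<open>A = _\<close> by (intro carrier_matI) (simp_all add: attitude_matrix_def mat_of_rows_list_def)
  note ev = eigenvalue_iff_mem_eigenvalue_mset[OF this]
  have spec: "eigenvalue_mset A = ?spec" if ?cond
  proof -
    let ?d = "sqrt (\<phi>2\<^sup>2 - 16 * \<phi>1)"
    have d: "?d\<^sup>2 = \<phi>2\<^sup>2 - 16 * \<phi>1" "0 \<le> ?d"
      using that by simp_all
    \<comment> \<open>This is where \<open>0 \<le> \<phi>1\<close> enters: it makes the smaller root \<open>(\<phi>2 - ?d) / 2\<close> nonnegative.\<close>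
    have "?d \<le> \<phi>2"
      using that by (intro real_le_lsqrt) auto
    then have nonneg: "0 \<le> (\<phi>2 + ?d) / 2" "0 \<le> (\<phi>2 - ?d) / 2"
      using that by (simp_all add: add_nonneg_nonneg)
    note b = real_sqrt_pow2[OF nonneg(1)] and c = real_sqrt_pow2[OF nonneg(2)]
    have "(sqrt ((\<phi>2 + ?d) / 2))\<^sup>2 + (sqrt ((\<phi>2 - ?d) / 2))\<^sup>2 = \<phi>2"
      unfolding b c by (simp add: field_simps)
    moreover have "(sqrt ((\<phi>2 + ?d) / 2))\<^sup>2 * (sqrt ((\<phi>2 - ?d) / 2))\<^sup>2 = 4 * \<phi>1"
      unfolding b c using d(1) by (simp add: power2_eq_square algebra_simps)
    moreover have "(sqrt (3 * \<sigma>2))\<^sup>2 = 3 * \<sigma>2"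
      using that by simp
    ultimately show ?thesis
      unfolding \<open>A = _\<close> \<phi>
      by (intro eigenvalue_mset_attitude_matrix)
         (simp_all only: flip: of_real_power of_real_add of_real_mult)
  qed
  have ?cond if stable: ?stable
  proof -
    \<comment> \<open>Roots are taken over the complex field, since no sign is known yet; stability makes them real.\<close>
    define d where "d = csqrt (\<phi>2\<^sup>2 - 16 * \<phi>1)"
    define a b c where "a = csqrt (3 * \<sigma>2)" and "b = csqrt ((\<phi>2 + d) / 2)"
      and "c = csqrt ((\<phi>2 - d) / 2)"
    have a: "a\<^sup>2 = of_real (3 * \<sigma>2)"
      by (simp add: a_def)
    have bc: "b\<^sup>2 + c\<^sup>2 = of_real \<phi>2" "b\<^sup>2 * c\<^sup>2 = of_real (4 * \<phi>1)"
    proof -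
      have "d\<^sup>2 = \<phi>2\<^sup>2 - 16 * \<phi>1" by (simp add: d_def)
      then show "b\<^sup>2 + c\<^sup>2 = of_real \<phi>2" "b\<^sup>2 * c\<^sup>2 = of_real (4 * \<phi>1)"
        unfolding b_def c_def power2_csqrt by (simp_all add: field_simps power2_eq_square)
    qed
    have mset: "eigenvalue_mset A = {# a * \<omega>0 * \<i>, - (a * \<omega>0 * \<i>), b * \<omega>0 * \<i>, - (b * \<omega>0 * \<i>),
        c * \<omega>0 * \<i>, - (c * \<omega>0 * \<i>) #}"
      unfolding \<open>A = _\<close> using a bc
      by (intro eigenvalue_mset_attitude_matrix) (simp_all add: \<phi>)
    have real: "r = of_real (Re r)" if "r \<in> {a, b, c}" for r
    proof -
      have "r * \<omega>0 * \<i> \<in># eigenvalue_mset A" "- (r * \<omega>0 * \<i>) \<in># eigenvalue_mset A"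
        using that unfolding mset by fastforce+
      then have "Re (r * \<omega>0 * \<i>) \<le> 0" "Re (- (r * \<omega>0 * \<i>)) \<le> 0"
        using stable ev by blast+
      then have "Im r * \<omega>0 = 0" by simp
      then show ?thesis using \<open>\<omega>0 > 0\<close> by (simp add: complex_eq_iff)
    qed
    obtain x y z where "a = of_real x" "b = of_real y" "c = of_real z"
      using real[of a] real[of b] real[of c] by blast
    with a bc have "complex_of_real (x\<^sup>2) = of_real (3 * \<sigma>2)"
      "complex_of_real (y\<^sup>2 + z\<^sup>2) = of_real \<phi>2" "complex_of_real (y\<^sup>2 * z\<^sup>2) = of_real (4 * \<phi>1)"
      by simp_all
    then have x: "3 * \<sigma>2 = x\<^sup>2" and yz: "\<phi>2 = y\<^sup>2 + z\<^sup>2" "4 * \<phi>1 = y\<^sup>2 * z\<^sup>2"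
      unfolding of_real_eq_iff by simp_all
    have "\<phi>2\<^sup>2 - 16 * \<phi>1 = (y\<^sup>2 + z\<^sup>2)\<^sup>2 - 4 * (y\<^sup>2 * z\<^sup>2)"
      using yz by simp
    also have "\<dots> = (y\<^sup>2 - z\<^sup>2)\<^sup>2"
      by (simp add: power2_eq_square algebra_simps)
    finally have "0 \<le> \<phi>2\<^sup>2 - 16 * \<phi>1"
      by simp
    moreover have "0 \<le> 3 * \<sigma>2" "0 \<le> 4 * \<phi>1" "0 \<le> \<phi>2"
      unfolding x yz by simp_all
    ultimately show ?cond
      by simp
  qed
  moreover have ?stable if ?cond
    unfolding ev spec[OF that] by auto
  ultimately show ?thesis using spec by blast
qed
end
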